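(* Let $(X,\sigma)$ be an infinite one-sided linearly recurrent shift with recurrence constant $K$, and let $(\bar X,\bar\sigma)$ be its two-sided version. Then $$|\mathrm{Aut}(X,\sigma)|\le 2(K+1)(2K+3)^2\quad\text{and}\quad |\mathrm{Aut}(\bar X,\bar\sigma)/\{\bar\sigma^n : n\in\mathbb Z\}|\le 2(K+1)(2K+3)^2.$$
   Context: Let $\mathcal A$ be a finite alphabet with the discrete topology and $\mathbb N_0=\{0,1,2,\dots\}$. A one-sided shift $(X,\sigma)$ is a closed shift-invariant subset $X\subseteq\mathcal A^{\mathbb N_0}$ (product topology) with the left shift $\sigma$; a two-sided shift is a closed shift-invariant subset of $\mathcal A^{\mathbb Z}$ with the left shift $\bar\sigma$. Minimal means that every orbit (forward orbit in the one-sided case) is dense. The language $\mathcal L_X$ is the set of all finite words occurring in points of $X$; $\ell(u)$ is the length of a word $u$. The two-sided version $(\bar X,\bar\sigma)$ of a one-sided minimal shift $(X,\sigma)$ is the set $\bar X$ of all bi-infinite sequences all of whose finite words lie in $\mathcal L_X$, with the shift $\bar\sigma$. An automorphism of a (one- or two-sided) shift is a continuous bijection of the space onto itself commuting with the shift map; $\mathrm{Aut}$ denotes the group of automorphisms. In the two-sided case, $\{\bar\sigma^n:n\in\mathbb Z\}$ is a normal subgroup of $\mathrm{Aut}(\bar X,\bar\sigma)$. For nonempty $u\in\mathcal L_X$ and $w\in\mathcal L_X$, $w$ is a return word to $u$ if (a) $u$ is a prefix of $w$, (b) $wu\in\mathcal L_X$, and (c) there are exactly two occurrences of $u$ in $wu$.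 (Condition (a) is as stated by the paper.) A minimal one-sided shift $(X,\sigma)$ is linearly recurrent if there is a constant $K$ such that for every nonempty word $u\in\mathcal L_X$ and every return word $w$ to $u$, $\ell(w)\le K\ell(u)$. Such a $K$ is called a recurrence constant. *)

theory Defs
  imports "HOL-Analysis.Function_Topology" "HOL-Library.Sublist" "HOL-Algebra.Coset" "HOL-Algebra.Bij"
begin

text \<open>
  The alphabet is a set \<open>A\<close>. The index type \<open>'i\<close> of sequences is instantiated with \<open>nat\<close>
  in the one-sided case and with \<open>int\<close> in the two-sided case.
\<close>

definition seq_topology :: "'a set \<Rightarrow> ('i \<Rightarrow> 'a) topology" where
  "seq_topology A = product_topology (\<lambda>_. discrete_topology A) UNIV"

definition left_shift :: "('i::semiring_1 \<Rightarrow> 'a) \<Rightarrow> 'i \<Rightarrow> 'a" where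
  "left_shift x = (\<lambda>i. x (i + 1))"

definition one_sided_shift :: "'a set \<Rightarrow> (nat \<Rightarrow> 'a) set \<Rightarrow> bool" where
  "one_sided_shift A X \<longleftrightarrow> closedin (seq_topology A) X \<and> left_shift ` X \<subseteq> X"

definition minimal_shift :: "'a set \<Rightarrow> (nat \<Rightarrow> 'a) set \<Rightarrow> bool" where
  "minimal_shift A X \<longleftrightarrow> one_sided_shift A X \<and>
     (\<forall>x\<in>X. subtopology (seq_topology A) X closure_of (range (\<lambda>n. (left_shift ^^ n) x)) = X)"

definition subword :: "('i::semiring_1 \<Rightarrow> 'a) \<Rightarrow> 'i \<Rightarrow> nat \<Rightarrow> 'a list" where
  "subword x i n = map (\<lambda>j. x (i + of_nat j)) [0..<n]"

definition language :: "('i::semiring_1 \<Rightarrow> 'a) set \<Rightarrow> 'a list set" where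
  "language X = {subword x i n | x i n. x \<in> X}"

definition two_sided_version :: "(nat \<Rightarrow> 'a) set \<Rightarrow> (int \<Rightarrow> 'a) set" where
  "two_sided_version X = {y. \<forall>i n. subword y i n \<in> language X}"

definition occurrences :: "'a list \<Rightarrow> 'a list \<Rightarrow> nat set" where
  "occurrences u v = {i. i + length u \<le> length v \<and> take (length u) (drop i v) = u}"

text \<open>
  The prefix condition is on \<open>w\<close> and not on \<open>w @ u\<close>, so a return word to \<open>u\<close>
  is never shorter than \<open>u\<close>.
\<close>

definition return_word :: "(nat \<Rightarrow> 'a) set \<Rightarrow> 'a list \<Rightarrow> 'a list \<Rightarrow> bool" where
  "return_word X u w \<longleftrightarrow> u \<noteq> [] \<and> u \<in> language X \<and> w \<in> language X \<and>
     prefix u w \<and> w @ u \<in> language X \<and> card (occurrences u (w @ u)) = 2"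

definition recurrence_constant :: "(nat \<Rightarrow> 'a) set \<Rightarrow> real \<Rightarrow> bool" where
  "recurrence_constant X K \<longleftrightarrow>
     (\<forall>u w. return_word X u w \<longrightarrow> real (length w) \<le> K * real (length u))"

definition linearly_recurrent :: "'a set \<Rightarrow> (nat \<Rightarrow> 'a) set \<Rightarrow> bool" where
  "linearly_recurrent A X \<longleftrightarrow> minimal_shift A X \<and> (\<exists>K. recurrence_constant X K)"

text \<open>
  Elements of \<^const>\<open>BijGroup\<close> are extensional functions, so distinct elements of the carrier
  below are distinct as maps on \<open>X\<close>. Inverses need no separate continuity requirement:
  \<open>X\<close> is compact Hausdorff for finite \<open>A\<close> and closed \<open>X\<close>.
\<close>

definition aut_group :: "'a set \<Rightarrow> ('i::semiring_1 \<Rightarrow> 'a) set \<Rightarrow> (('i \<Rightarrow> 'a) \<Rightarrow> ('i \<Rightarrow> 'a)) monoid" where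
  "aut_group A X = BijGroup X \<lparr>carrier :=
     {f \<in> Bij X. continuous_map (subtopology (seq_topology A) X) (subtopology (seq_topology A) X) f
        \<and> (\<forall>x\<in>X. f (left_shift x) = left_shift (f x))}\<rparr>"

definition shift_powers :: "'a set \<Rightarrow> (int \<Rightarrow> 'a) set \<Rightarrow> ((int \<Rightarrow> 'a) \<Rightarrow> (int \<Rightarrow> 'a)) set" where
  "shift_powers A Y = {restrict left_shift Y [^]\<^bsub>aut_group A Y\<^esub> n | n :: int. True}"

end

theory Submission
  imports Defs "HOL-Algebra.Generated_Groups" "HOL-Analysis.Abstract_Topological_Spaces"
begin

text \<open>
  Call a point of \<open>X\<close> left special if it has two preimages under the shift. Distinct left special
  points have distinct long prefixes, and each such prefix extends to the left in two ways, so \<open>m\<close>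
  left special points make the number of words of length \<open>n\<close> grow by at least \<open>m\<close> at each step.
  Since consecutive occurrences of a word of length \<open>n\<close> are at most \<open>K n\<close> apart, there are at most
  \<open>K n\<close> such words, and hence \<open>m \<le> K\<close>. This replaces Cassaigne's bound on the complexity
  differences, and it is stronger than what the theorem asks for.

  Since \<open>X\<close> is infinite, a left special point exists by compactness. An automorphism of \<open>X\<close> permutes
  the left special points and, by minimality, is determined by its value at one of them. In the
  two-sided case fix points \<open>x \<noteq> y\<close> with a common right tail. An automorphism \<open>f\<close> maps them to another
  such pair, and the right half of \<open>f x\<close> after the last disagreement with \<open>f y\<close> is left special; it
  determines \<open>f\<close> up to a power of the shift, because every word recurs in every right tail.
\<close>

section \<open>Sequence spaces\<close>

abbreviation shift_space :: "'a set \<Rightarrow> ('i \<Rightarrow> 'a) set \<Rightarrow> ('i \<Rightarrow> 'a) topology" where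
  "shift_space A X \<equiv> subtopology (seq_topology A) X"

lemma topspace_seq_topology: "topspace (seq_topology A) = {x. range x \<subseteq> A}"
  by (auto simp: seq_topology_def)

lemma Hausdorff_seq_topology: "Hausdorff_space (seq_topology A)"
  by (simp add: seq_topology_def Hausdorff_space_product_topology Hausdorff_space_discrete_topology)

lemma compact_seq_topology: "finite A \<Longrightarrow> compact_space (seq_topology A)"
  by (simp add: seq_topology_def compact_space_product_topology compact_space_discrete_topology)

lemma topspace_shift_space:
  "closedin (seq_topology A) X \<Longrightarrow> topspace (shift_space A X) = X"
  using closedin_subset by (metis topspace_subtopology_subset)

lemma compact_shift_space:
  "finite A \<Longrightarrow> closedin (seq_topology A) X \<Longrightarrow> compact_space (shift_space A X)"
  by (metis closedin_compact_space compact_seq_topology compact_space_subtopology)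

lemma Hausdorff_shift_space: "Hausdorff_space (shift_space A X)"
  by (simp add: Hausdorff_seq_topology Hausdorff_space_subtopology)

lemma continuous_map_coordinate: "continuous_map (seq_topology A) (discrete_topology A) (\<lambda>x. x i)"
  unfolding seq_topology_def by (rule continuous_map_product_projection) simp

lemma continuous_map_seqI:
  assumes "\<And>i. continuous_map T (discrete_topology A) (\<lambda>x. f x i)"
  shows "continuous_map T (seq_topology A) f"
  unfolding seq_topology_def using assms by (simp add: continuous_map_componentwise_UNIV)

lemma openin_cylinder:
  assumes "finite J"
  shows "openin (seq_topology A) {x \<in> topspace (seq_topology A). \<forall>j\<in>J. x j = z j}"
  using assms
proof (induction J)
  case empty
  then show ?case by simp
next
  case (insert j J)
  \<comment> \<open>The letter \<open>z j\<close> may lie outside \<open>A\<close>. Cutting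
    \<open>{z j}\<close> down to \<open>A\<close> makes it open and loses nothing, since all points
    take values in \<open>A\<close>.\<close>
  have "openin (seq_topology A) {x \<in> topspace (seq_topology A). x j \<in> {z j} \<inter> A}"
    by (rule openin_continuous_map_preimage[OF continuous_map_coordinate]) simp
  moreover have "{x \<in> topspace (seq_topology A). \<forall>j\<in>insert j J. x j = z j} =
      {x \<in> topspace (seq_topology A). x j \<in> {z j} \<inter> A} \<inter> {x \<in> topspace (seq_topology A). \<forall>j\<in>J. x j = z j}"
    by (auto simp: topspace_seq_topology)
  ultimately show ?case using insert.IH by (simp only: openin_Int)
qed

text \<open>Cylinders over finite index sets form a neighbourhood base: they are open, and a basic
  open set of the product restricts only finitely many coordinates.\<close>

lemma in_seq_closure_iff:
  "z \<in> seq_topology A closure_of S \<longleftrightarrow>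
    range z \<subseteq> A \<and> (\<forall>J. finite J \<longrightarrow> (\<exists>y\<in>S. range y \<subseteq> A \<and> (\<forall>j\<in>J. y j = z j)))" (is "?L \<longleftrightarrow> ?R")
proof
  assume L: ?L
  have zA: "range z \<subseteq> A" using L by (simp add: in_closure_of topspace_seq_topology)
  have "\<exists>y\<in>S. range y \<subseteq> A \<and> (\<forall>j\<in>J. y j = z j)" if "finite J" for J
  proof -
    let ?C = "{x \<in> topspace (seq_topology A). \<forall>j\<in>J. x j = z j}"
    have "z \<in> ?C" using zA by (simp add: topspace_seq_topology)
    moreover have "openin (seq_topology A) ?C" by (rule openin_cylinder[OF \<open>finite J\<close>])
    moreover have "\<forall>T. z \<in> T \<and> openin (seq_topology A) T \<longrightarrow> (\<exists>y. y \<in> S \<and> y \<in> T)"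
      using L unfolding in_closure_of by (rule conjunct2)
    ultimately have "\<exists>y. y \<in> S \<and> y \<in> ?C" by (meson)
    then show ?thesis unfolding topspace_seq_topology by blast
  qed
  with zA show ?R by blast
next
  assume R: ?R
  have "\<exists>y. y \<in> S \<and> y \<in> T" if T: "z \<in> T" "openin (seq_topology A) T" for T
  proof -
    have "\<exists>U. finite {i \<in> UNIV. U i \<noteq> topspace (discrete_topology A)} \<and>
        (\<forall>i\<in>UNIV. openin (discrete_topology A) (U i)) \<and> z \<in> Pi\<^sub>E UNIV U \<and> Pi\<^sub>E UNIV U \<subseteq> T"
      using T unfolding seq_topology_def openin_product_topology_alt by blast
    then obtain U where U: "finite {i. U i \<noteq> A}" "z \<in> Pi\<^sub>E UNIV U" "Pi\<^sub>E UNIV U \<subseteq> T"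
      by auto
    obtain y where y: "y \<in> S" "range y \<subseteq> A" "\<forall>j\<in>{i. U i \<noteq> A}. y j = z j" using R U(1) by meson
    have "y i \<in> U i" for i
      using y U(2) by (cases "U i = A") (auto simp: PiE_iff)
    then have "y \<in> Pi\<^sub>E UNIV U" by auto
    with U y(1) show ?thesis by blast
  qed
  then show ?L using R by (auto simp: in_closure_of topspace_seq_topology)
qed

section \<open>Uniform continuity by compactness\<close>

text \<open>The pairs that agree on \<open>J n\<close> but have different values under
  \<open>f\<close> form a decreasing sequence of closed sets in the compact square of
  \<open>X\<close>; a pair in all of them would contradict \<open>det\<close>. The windows may fill
  only part of the index set, for example the positive positions.\<close>

lemma uniform_window:
  fixes f :: "('i \<Rightarrow> 'a) \<Rightarrow> 'b" and J :: "nat \<Rightarrow> 'i set"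
  assumes fin: "finite A" and cl: "closedin (seq_topology A) X"
    and f: "continuous_map (shift_space A X) (discrete_topology B) f" and J: "incseq J"
    and det: "\<And>x y. x \<in> X \<Longrightarrow> y \<in> X \<Longrightarrow> (\<And>j. j \<in> (\<Union>n. J n) \<Longrightarrow> x j = y j) \<Longrightarrow> f x = f y"
  shows "\<exists>n. \<forall>x\<in>X. \<forall>y\<in>X. (\<forall>j\<in>J n. x j = y j) \<longrightarrow> f x = f y"
proof (rule ccontr)
  assume con: "\<not> ?thesis"
  let ?T = "shift_space A X"
  let ?TT = "prod_topology ?T ?T"
  define C where "C n = {p \<in> X \<times> X. f (fst p) \<noteq> f (snd p)} \<inter> {p \<in> X \<times> X. \<forall>j\<in>J n. fst p j = snd p j}" for n
  have tT: "topspace ?T = X" by (rule topspace_shift_space[OF cl])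
  have tTT: "topspace ?TT = X \<times> X" by (simp only: topspace_prod_topology tT)
  have proj: "continuous_map ?TT ?T fst" "continuous_map ?TT ?T snd"
    by (simp_all add: continuous_map_fst continuous_map_snd)
  have coord: "continuous_map ?T (discrete_topology A) (\<lambda>x. x j)" for j
    by (simp add: continuous_map_coordinate continuous_map_from_subtopology)
  \<comment> \<open>In a discrete space the complement of the diagonal is closed, so the pairs with
    different values form a closed set, as its preimage.\<close>
  have "continuous_map ?TT (prod_topology (discrete_topology B) (discrete_topology B)) (\<lambda>p. (f (fst p), f (snd p)))"
    using continuous_map_compose[OF proj(1) f] continuous_map_compose[OF proj(2) f]
    by (simp add: continuous_map_paired o_def)
  then have "continuous_map ?TT (discrete_topology (B \<times> B)) (\<lambda>p. (f (fst p), f (snd p)))"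
    by (simp add: prod_topology_discrete_topology)
  then have pre: "closedin ?TT {p \<in> topspace ?TT. (f (fst p), f (snd p)) \<in> (B \<times> B) - Id}"
    by (rule closedin_continuous_map_preimage) auto
  have "f x \<in> B" if "x \<in> X" for x
    using f that tT by (auto simp: continuous_map_def)
  then have "{p \<in> topspace ?TT. (f (fst p), f (snd p)) \<in> (B \<times> B) - Id} = {p \<in> X \<times> X. f (fst p) \<noteq> f (snd p)}"
    unfolding tTT by fastforce
  with pre have c1: "closedin ?TT {p \<in> X \<times> X. f (fst p) \<noteq> f (snd p)}"
    by (simp only:)
  have cj: "closedin ?TT {p \<in> X \<times> X. fst p j = snd p j}" for j
    using closedin_continuous_maps_eq[OF Hausdorff_space_discrete_topology
        continuous_map_compose[OF proj(1) coord] continuous_map_compose[OF proj(2) coord], of j j]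
    unfolding tTT o_def .
  have c2: "closedin ?TT {p \<in> X \<times> X. \<forall>j\<in>J n. fst p j = snd p j}" for n
  proof -
    have "{p \<in> X \<times> X. \<forall>j\<in>J n. fst p j = snd p j} = topspace ?TT \<inter> (\<Inter>j\<in>J n. {p \<in> X \<times> X. fst p j = snd p j})"
      unfolding tTT by auto
    \<comment> \<open>An intersection over the empty set is \<open>UNIV\<close>, so an empty window
      is split off.\<close>
    moreover have "closedin ?TT (\<Inter>j\<in>J n. {p \<in> X \<times> X. fst p j = snd p j})" if "J n \<noteq> {}"
      by (rule closedin_Inter) (use cj that in auto)
    ultimately show ?thesis
      by (cases "J n = {}") (simp_all only: closedin_Int closedin_topspace INT_empty Int_UNIV_right HOL.simp_thms)
  qed
  have "\<Inter> (range C) \<noteq> {}"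
  proof (rule compact_space_imp_nest)
    show "compact_space ?TT"
      by (simp add: compact_space_prod_topology compact_shift_space[OF fin cl])
    show "closedin ?TT (C n)" for n
      unfolding C_def using c1 c2 by (rule closedin_Int)
    show "C n \<noteq> {}" for n
      using con unfolding C_def by fastforce
    show "decseq C"
      using J unfolding C_def decseq_def incseq_def by blast
  qed
  then obtain p where p: "\<And>n. p \<in> C n" by blast
  then have "p \<in> X \<times> X" "f (fst p) \<noteq> f (snd p)" "\<And>j n. j \<in> J n \<Longrightarrow> fst p j = snd p j"
    unfolding C_def by auto
  with det[of "fst p" "snd p"] show False by (metis UN_E mem_Times_iff)
qed

lemma subword_eq_iff: "subword x i n = subword y k n \<longleftrightarrow> (\<forall>j<n. x (i + of_nat j) = y (k + of_nat j))"
  by (auto simp: subword_def)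

lemma length_subword [simp]: "length (subword x i n) = n"
  by (simp add: subword_def)

lemma nth_subword [simp]: "j < n \<Longrightarrow> subword x i n ! j = x (i + of_nat j)"
  by (simp add: subword_def)

lemma left_shift_funpow: "(left_shift ^^ n) x = (\<lambda>i. x (i + of_nat n))"
  by (induction n arbitrary: x) (simp_all add: left_shift_def algebra_simps)

lemma continuous_left_shift:
  assumes "closedin (seq_topology A) X" "left_shift ` X \<subseteq> X"
  shows "continuous_map (shift_space A X) (shift_space A X) left_shift"
proof -
  have "continuous_map (shift_space A X) (seq_topology A) left_shift"
    unfolding left_shift_def
    by (rule continuous_map_seqI)
      (simp add: continuous_map_coordinate continuous_map_from_subtopology)
  then show ?thesis
    using assms by (auto simp: continuous_map_in_subtopology topspace_shift_space)
qed

lemma separating_prefix: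
  fixes F :: "(nat \<Rightarrow> 'a) set"
  assumes "finite F"
  shows "\<exists>N. \<forall>x\<in>F. \<forall>y\<in>F. (\<forall>j<N. x j = y j) \<longrightarrow> x = y"
proof -
  obtain d where d: "\<And>x y. x \<noteq> y \<Longrightarrow> x (d x y) \<noteq> (y :: nat \<Rightarrow> 'a) (d x y)"
    by (metis ext)
  have "finite ((\<lambda>(x, y). d x y) ` (F \<times> F))" using assms by simp
  then obtain N where "\<forall>m\<in>(\<lambda>(x, y). d x y) ` (F \<times> F). m < N"
    using finite_nat_set_iff_bounded by blast
  then have "\<forall>x\<in>F. \<forall>y\<in>F. d x y < N" by auto
  with d show ?thesis by blast
qed

section \<open>Words of a minimal shift\<close>

definition left_special :: "(nat \<Rightarrow> 'a) set \<Rightarrow> (nat \<Rightarrow> 'a) set" where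
  "left_special X = {x. \<exists>y\<in>X. \<exists>z\<in>X. y \<noteq> z \<and> left_shift y = x \<and> left_shift z = x}"

definition words :: "(nat \<Rightarrow> 'a) set \<Rightarrow> nat \<Rightarrow> 'a list set" where
  "words X n = {u \<in> language X. length u = n}"

locale minimal_subshift =
  fixes A :: "'a set" and X :: "(nat \<Rightarrow> 'a) set"
  assumes finite_alphabet: "finite A" and minimal: "minimal_shift A X"
begin

lemma closed: "closedin (seq_topology A) X"
  using minimal by (simp add: minimal_shift_def one_sided_shift_def)

lemma shift_closed: "x \<in> X \<Longrightarrow> left_shift x \<in> X"
  using minimal by (auto simp: minimal_shift_def one_sided_shift_def)

lemma shift_by_closed: "x \<in> X \<Longrightarrow> (\<lambda>i. x (i + n)) \<in> X"
proof -
  assume "x \<in> X"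
  then have "(left_shift ^^ n) x \<in> X" by (induction n) (simp_all add: shift_closed)
  then show ?thesis by (simp add: left_shift_funpow)
qed

lemma letters: "x \<in> X \<Longrightarrow> x i \<in> A"
  using closedin_subset[OF closed] by (auto simp: topspace_seq_topology)

lemma orbit_dense: "x \<in> X \<Longrightarrow> shift_space A X closure_of range (\<lambda>n. (left_shift ^^ n) x) = X"
  using minimal by (simp add: minimal_shift_def)

lemma subword_in_language: "x \<in> X \<Longrightarrow> subword x i n \<in> language X"
  by (auto simp: language_def)

lemma language_prefixE:
  assumes "u \<in> language X"
  obtains x where "x \<in> X" "subword x 0 (length u) = u"
proof -
  obtain y i n where y: "y \<in> X" "u = subword y i n" using assms by (auto simp: language_def)
  have "subword (\<lambda>j. y (j + i)) 0 n = subword y i n"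
    by (simp add: subword_eq_iff add.commute)
  then show ?thesis using that[OF shift_by_closed[OF y(1), of i]] y by simp
qed

text \<open>Minimality is applied to \<open>x\<close> shifted by \<open>N\<close>: an occurrence of
  \<open>u\<close> in that point lies at a position at least \<open>N\<close> in
  \<open>x\<close>.\<close>

lemma recurrent:
  assumes x: "x \<in> X" and u: "u \<in> language X"
  shows "\<exists>p\<ge>N. subword x p (length u) = u"
proof -
  obtain z where z: "z \<in> X" "subword z 0 (length u) = u" using language_prefixE[OF u] .
  let ?O = "range (\<lambda>n. (left_shift ^^ n) (\<lambda>i. x (i + N)))"
  have "z \<in> seq_topology A closure_of (X \<inter> ?O)"
    using orbit_dense[OF shift_by_closed[OF x, of N]] z(1) unfolding closure_of_subtopology by blast
  then have "\<forall>J. finite J \<longrightarrow> (\<exists>y\<in>X \<inter> ?O. range y \<subseteq> A \<and> (\<forall>j\<in>J. y j = z j))"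
    unfolding in_seq_closure_iff by blast
  then obtain y where y: "y \<in> ?O" "\<forall>j\<in>{..<length u}. y j = z j" by (meson IntD2 finite_lessThan)
  then obtain n where n: "y = (\<lambda>i. x (i + n + N))" by (auto simp: left_shift_funpow)
  have "subword x (n + N) (length u) = subword z 0 (length u)"
    using y(2) unfolding subword_eq_iff n by (auto simp: algebra_simps)
  then show ?thesis using z(2) by (metis le_add2)
qed

text \<open>Every prefix of \<open>z\<close> is a prefix of some point of \<open>X\<close>, so
  \<open>z\<close> lies in the closure of \<open>X\<close>, which is closed.\<close>

lemma mem_if_words_in_language:
  assumes "\<And>n. subword z 0 n \<in> language X"
  shows "z \<in> X"
proof -
  have agree: "\<exists>y\<in>X. \<forall>j<n. y j = z j" for n
  proof -
    obtain y where "y \<in> X" "subword y 0 n = subword z 0 n"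
      using language_prefixE[OF assms[of n]] by auto
    then show ?thesis by (auto simp: subword_eq_iff)
  qed
  have "z i \<in> A" for i
    using agree[of "Suc i"] letters by (metis lessI)
  moreover have "\<exists>y\<in>X. range y \<subseteq> A \<and> (\<forall>j\<in>J. y j = z j)" if "finite J" for J
  proof -
    obtain n where "\<forall>j\<in>J. j < n" using \<open>finite J\<close> finite_nat_set_iff_bounded by blast
    moreover obtain y where "y \<in> X" "\<forall>j<n. y j = z j" using agree by blast
    ultimately show ?thesis using letters[of y] by (intro bexI[of _ y]) auto
  qed
  ultimately have "z \<in> seq_topology A closure_of X"
    unfolding in_seq_closure_iff by (simp add: image_subset_iff)
  then show ?thesis using closed by (simp add: closure_of_closedin)
qed

text \<open>By compactness the image of the shift is closed, and it contains the dense forward orbit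
  of \<open>left_shift x\<close>.\<close>

lemma shift_surj:
  assumes "x \<in> X"
  obtains y where "y \<in> X" "left_shift y = x"
proof -
  let ?T = "shift_space A X"
  have "closed_map ?T ?T left_shift"
    using continuous_left_shift[OF closed] shift_closed
    by (intro continuous_imp_closed_map) (auto simp: compact_shift_space finite_alphabet closed Hausdorff_shift_space)
  then have "closedin ?T (left_shift ` X)"
    by (metis closed closed_map_def closedin_topspace topspace_shift_space)
  moreover have "range (\<lambda>n. (left_shift ^^ n) (left_shift x)) \<subseteq> left_shift ` X"
  proof -
    have "(left_shift ^^ n) (left_shift x) = left_shift ((left_shift ^^ n) x)" for n
      by (simp add: funpow_swap1)
    moreover have "(left_shift ^^ n) x \<in> X" for n
      using shift_by_closed[OF assms] by (simp add: left_shift_funpow)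
    ultimately show ?thesis by auto
  qed
  ultimately have "X \<subseteq> left_shift ` X"
    using orbit_dense[OF shift_closed[OF assms]] closure_of_minimal by metis
  then show ?thesis using assms that by blast
qed

text \<open>Otherwise the shift is injective, so the first letter is determined by the rest and, by
  compactness, by the next \<open>r\<close> letters. Iterating to the left, a block of length
  \<open>r\<close> determines everything before it, and there are only finitely many blocks.\<close>

lemma left_special_nonempty:
  assumes "infinite X"
  shows "left_special X \<noteq> {}"
proof
  assume "left_special X = {}"
  then have inj: "y = z" if "y \<in> X" "z \<in> X" "left_shift y = left_shift z" for y z
    using that unfolding left_special_def by blast
  have "\<exists>r. \<forall>x\<in>X. \<forall>y\<in>X. (\<forall>j\<in>{1..r}. x j = y j) \<longrightarrow> x 0 = y 0"
  proof (rule uniform_window[OF finite_alphabet closed])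
    show "continuous_map (shift_space A X) (discrete_topology A) (\<lambda>x. x 0)"
      by (simp add: continuous_map_coordinate continuous_map_from_subtopology)
    show "incseq (\<lambda>r. {1..r::nat})" by (auto simp: incseq_def)
    show "x 0 = y 0" if "x \<in> X" "y \<in> X" "\<And>j. j \<in> (\<Union>r. {1..r}) \<Longrightarrow> x j = y j" for x y
    proof -
      have "left_shift x = left_shift y" using that(3) by (auto simp: left_shift_def fun_eq_iff)
      with inj that show ?thesis by metis
    qed
  qed
  then obtain r where r: "\<And>x y. x \<in> X \<Longrightarrow> y \<in> X \<Longrightarrow> (\<forall>j\<in>{1..r}. x j = y j) \<Longrightarrow> x 0 = y 0" by blast
  have det: "\<forall>j\<le>n. x j = y j" if "x \<in> X" "y \<in> X" "\<forall>j\<in>{Suc n..n + r}. x j = y j" for x y n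
    using that
  proof (induction n arbitrary: x y)
    case 0
    then show ?case using r[of x y] by auto
  next
    case (Suc n)
    \<comment> \<open>The shifted points agree on the block of the induction hypothesis, which gives
      positions 1 to \<open>Suc n\<close>; the local rule \<open>r\<close> then supplies position
      0.\<close>
    have "\<forall>j\<in>{Suc n..n + r}. left_shift x j = left_shift y j"
      using Suc.prems(3) by (auto simp: left_shift_def)
    with Suc.IH Suc.prems shift_closed have "\<forall>j\<le>n. left_shift x j = left_shift y j" by blast
    then have *: "x j = y j" if "1 \<le> j" "j \<le> Suc n" for j
      using that by (cases j) (auto simp: left_shift_def)
    with Suc.prems(3) have "\<forall>j\<in>{1..r}. x j = y j"
      by (metis Suc.prems(3) add_Suc atLeastAtMost_iff le_add2 le_trans not_less_eq_eq)
    with r Suc.prems have "x 0 = y 0" by blast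
    with * show ?case by (metis One_nat_def Suc_leI not_gr_zero)
  qed
  let ?W = "{u. set u \<subseteq> A \<and> length u = r}"
  have finW: "finite ?W" by (rule finite_lists_length_eq[OF finite_alphabet])
  \<comment> \<open>Pigeonhole: with more points than words of length \<open>r\<close>, two share
    the block at \<open>Suc N\<close> and hence all letters up to \<open>N\<close>, although their
    prefixes of length \<open>N\<close> separate them.\<close>
  obtain F where F: "finite F" "card F = Suc (card ?W)" "F \<subseteq> X"
    using infinite_arbitrarily_large[OF assms] by blast
  obtain N where N: "\<forall>x\<in>F. \<forall>y\<in>F. (\<forall>j<N. x j = y j) \<longrightarrow> x = y" using separating_prefix[OF F(1)] by blast
  have "inj_on (\<lambda>x. subword x (Suc N) r) F"
  proof (rule inj_onI)
    fix x y assume xy: "x \<in> F" "y \<in> F" "subword x (Suc N) r = subword y (Suc N) r"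
    have "x j = y j" if "j \<in> {Suc N..N + r}" for j
      using xy(3) that unfolding subword_eq_iff
      by (metis add_Suc atLeastAtMost_iff le_imp_less_Suc nat_add_left_cancel_less nat_le_iff_add of_nat_id)
    with det[of x y N] xy F(3) have "\<forall>j\<le>N. x j = y j" by blast
    with N xy show "x = y" by (meson less_imp_le)
  qed
  moreover have "(\<lambda>x. subword x (Suc N) r) ` F \<subseteq> ?W"
    using letters[OF subsetD[OF F(3)]] by (auto simp: subword_def)
  ultimately have "card F \<le> card ?W" using finW by (rule card_inj_on_le)
  with F(2) show False by simp
qed

lemma finite_words: "finite (words X n)"
proof (rule finite_subset)
  show "words X n \<subseteq> {u. set u \<subseteq> A \<and> length u = n}"
    using letters by (auto simp: words_def language_def subword_def)
qed (rule finite_lists_length_eq[OF finite_alphabet])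

text \<open>Group the words of length \<open>Suc n\<close> by their tail. Each word of length
  \<open>n\<close> has a left extension because the shift is onto; the prefix of a left special
  point has two. The last hypothesis makes the prefixes of points of \<open>F\<close>
  distinct.\<close>

lemma card_words_Suc:
  assumes "finite F" "F \<subseteq> left_special X" "\<forall>x\<in>F. \<forall>y\<in>F. (\<forall>j<n. x j = y j) \<longrightarrow> x = y"
  shows "card (words X n) + card F \<le> card (words X (Suc n))"
proof -
  define B where "B v = {u \<in> words X (Suc n). tl u = v}" for v
  let ?P = "(\<lambda>x. subword x 0 n) ` F"
  have finB: "finite (B v)" for v by (simp add: B_def finite_words)
  have cons: "y 0 # subword x 0 n \<in> B (subword x 0 n)" if "y \<in> X" "left_shift y = x" for x y
  proof -
    have "y 0 # subword x 0 n = subword y 0 (Suc n)"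
      using that(2) by (auto simp: subword_def left_shift_def upt_conv_Cons map_Suc_upt[symmetric] simp del: upt_Suc)
    moreover have "subword y 0 (Suc n) \<in> words X (Suc n)"
      using that(1) by (simp add: words_def subword_in_language)
    ultimately show ?thesis unfolding B_def by (metis (mono_tags, lifting) list.sel(3) mem_Collect_eq)
  qed
  have one: "1 \<le> card (B v)" if "v \<in> words X n" for v
  proof -
    from that obtain x where x: "x \<in> X" "subword x 0 n = v"
      using language_prefixE unfolding words_def by (metis (mono_tags, lifting) mem_Collect_eq)
    obtain y where "y \<in> X" "left_shift y = x" using shift_surj[OF x(1)] .
    with cons x(2) have "B v \<noteq> {}" by blast
    with finB show ?thesis by (simp add: Suc_le_eq card_gt_0_iff)
  qed
  have two: "2 \<le> card (B v)" if "v \<in> ?P" for v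
  proof -
    from that obtain x where x: "x \<in> F" "subword x 0 n = v" by blast
    with assms(2) obtain y z where yz: "y \<in> X" "z \<in> X" "y \<noteq> z" "left_shift y = x" "left_shift z = x"
      unfolding left_special_def by blast
    \<comment> \<open>Two preimages of one point can differ only in their first letter.\<close>
    have "y 0 \<noteq> z 0"
    proof
      assume "y 0 = z 0"
      moreover have "y (Suc i) = z (Suc i)" for i
        using yz(4,5) by (auto simp: left_shift_def fun_eq_iff)
      ultimately have "y i = z i" for i by (cases i) auto
      with yz(3) show False by blast
    qed
    moreover have "{y 0 # v, z 0 # v} \<subseteq> B v" using cons yz x(2) by blast
    ultimately show ?thesis using card_mono[OF finB, of "{y 0 # v, z 0 # v}" v] by simp
  qed
  have P: "?P \<subseteq> words X n"
    using assms(2) shift_closed subword_in_language unfolding words_def left_special_def by fastforce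
  have "inj_on (\<lambda>x. subword x 0 n) F"
    using assms(3) by (auto simp: inj_on_def subword_eq_iff)
  then have cardP: "card ?P = card F" by (rule card_image)
  have U: "words X (Suc n) = (\<Union>v\<in>words X n. B v)"
  proof -
    have "tl u \<in> words X n" if u: "u \<in> words X (Suc n)" for u
    proof -
      obtain x where x: "x \<in> X" "subword x 0 (Suc n) = u"
        using u language_prefixE unfolding words_def by (metis (mono_tags, lifting) mem_Collect_eq)
      have "tl u = subword x 1 n"
        unfolding x(2)[symmetric] by (auto simp: subword_def upt_conv_Cons map_Suc_upt[symmetric] simp del: upt_Suc)
      with x(1) show ?thesis by (simp add: words_def subword_in_language)
    qed
    then show ?thesis unfolding B_def by auto
  qed
  have "card (words X n) + card F = (\<Sum>v\<in>words X n. 1 + (if v \<in> ?P then 1 else 0))"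
  proof -
    have "(\<Sum>v\<in>words X n. if v \<in> ?P then 1 else 0) = card (words X n \<inter> ?P)"
      using finite_words by (simp add: sum.If_cases)
    also have "words X n \<inter> ?P = ?P" using P by blast
    finally show ?thesis by (simp only: sum.distrib cardP) simp
  qed
  also have "\<dots> \<le> (\<Sum>v\<in>words X n. card (B v))"
    by (rule sum_mono) (use one two in fastforce)
  also have "\<dots> = card (words X (Suc n))"
    unfolding U by (subst card_UN_disjoint) (use finite_words finB in \<open>auto simp: B_def\<close>)
  finally show ?thesis .
qed

end

section \<open>Return words, gaps between occurrences and linear complexity\<close>

lemma subword_append: "subword x q m @ subword x (q + of_nat m) n = subword x q (m + n)"
  by (rule nth_equalityI) (auto simp: nth_append add.assoc simp flip: of_nat_add)

lemma take_drop_subword: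
  "i + n \<le> m \<Longrightarrow> take n (drop i (subword x q m)) = subword x (q + of_nat i) n"
  by (rule nth_equalityI) (auto simp: algebra_simps)

context minimal_subshift
begin

text \<open>The word between two consecutive occurrences is a return word once the gap
  \<open>g\<close> is at least \<open>n\<close>; this bound is what the prefix condition
  demands.\<close>

lemma return_word_of_gap:
  assumes x: "x \<in> X" and n: "1 \<le> n" "n \<le> g"
    and occ: "subword x (q + g) n = subword x q n"
    and between: "\<And>p. q < p \<Longrightarrow> p < q + g \<Longrightarrow> subword x p n \<noteq> subword x q n"
  shows "return_word X (subword x q n) (subword x q g)"
proof -
  have app: "subword x q g @ subword x q n = subword x q (g + n)"
    using subword_append[of x q g n] occ by simp
  have "occurrences (subword x q n) (subword x q (g + n)) = {0, g}"
  proof -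
    have "i \<in> occurrences (subword x q n) (subword x q (g + n)) \<longleftrightarrow>
        i \<le> g \<and> subword x (q + i) n = subword x q n" for i
      using take_drop_subword[of i n "g + n" x q] by (auto simp: occurrences_def)
    moreover have "i = 0 \<or> i = g" if "i \<le> g" "subword x (q + i) n = subword x q n" for i
      using between[of "q + i"] that by fastforce
    ultimately show ?thesis using occ by auto
  qed
  moreover have "card {0, g} = 2" using n by simp
  moreover have "prefix (subword x q n) (subword x q g)"
    using take_drop_subword[of 0 n g x q] n take_is_prefix[of n "subword x q g"] by simp
  moreover have "subword x q n \<noteq> []" using n by (simp add: subword_def)
  ultimately show ?thesis
    unfolding return_word_def app using subword_in_language[OF x] by simp
qed

lemma next_occurrence:
  assumes "x \<in> X" "u \<in> language X"
  obtains p where "q < p" "subword x p (length u) = u"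
    "\<And>p'. q < p' \<Longrightarrow> p' < p \<Longrightarrow> subword x p' (length u) \<noteq> u"
proof -
  let ?Q = "\<lambda>p. q < p \<and> subword x p (length u) = u"
  obtain p0 where "p0 \<ge> Suc q" "subword x p0 (length u) = u"
    using recurrent[OF assms, of "Suc q"] by blast
  then have "?Q p0" by simp
  then have "?Q (LEAST p. ?Q p)" by (rule LeastI)
  moreover have "\<not> ?Q p'" if "p' < (LEAST p. ?Q p)" for p' using not_less_Least[OF that] .
  ultimately show ?thesis using that by blast
qed

text \<open>For a single letter every positive gap is long enough to give a return word, so
  \<open>K\<close> bounds a positive integer.\<close>

lemma recurrence_constant_ge_1:
  assumes "recurrence_constant X K" "X \<noteq> {}"
  shows "1 \<le> K"
proof -
  obtain x where x: "x \<in> X" using assms(2) by blast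
  have len: "length (subword x 0 1) = 1" by simp
  obtain p where p: "0 < p" "subword x p 1 = subword x 0 1"
    "\<And>p'. 0 < p' \<Longrightarrow> p' < p \<Longrightarrow> subword x p' 1 \<noteq> subword x 0 1"
    using next_occurrence[OF x subword_in_language[OF x, of 0 1], of 0] unfolding len by blast
  have "return_word X (subword x 0 1) (subword x 0 p)"
    by (rule return_word_of_gap[OF x]) (use p in auto)
  then have "real p \<le> K" using assms(1) unfolding recurrence_constant_def by fastforce
  with p(1) show ?thesis by linarith
qed

text \<open>A gap shorter than \<open>n\<close> gives no return word, but then it is bounded by
  \<open>K * real n\<close> because \<open>1 \<le> K\<close>.\<close>

lemma gap_le:
  assumes K: "recurrence_constant X K" and x: "x \<in> X" and n: "1 \<le> n" and q: "q < q'"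
    and occ: "subword x q' n = subword x q n"
    and between: "\<And>p. q < p \<Longrightarrow> p < q' \<Longrightarrow> subword x p n \<noteq> subword x q n"
  shows "real q' \<le> real q + K * real n"
proof (cases "n \<le> q' - q")
  case True
  have "return_word X (subword x q n) (subword x q (q' - q))"
    by (rule return_word_of_gap[OF x n True]) (use occ between q in auto)
  then have "real (q' - q) \<le> K * real n" using K unfolding recurrence_constant_def by fastforce
  then show ?thesis using q by (simp add: of_nat_diff)
next
  case False
  have "1 \<le> K" using recurrence_constant_ge_1 K x by blast
  then have "1 * real n \<le> K * real n" by (intro mult_right_mono) auto
  then show ?thesis using False by linarith
qed

text \<open>Far enough to the right in one point \<open>x\<close>, every word of length
  \<open>n\<close> starts somewhere in a fixed window of \<open>m\<close> consecutive positions, so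
  there are at most \<open>m\<close> words.\<close>

lemma card_words_le:
  assumes K: "recurrence_constant X K" and "X \<noteq> {}" and n: "1 \<le> n"
  shows "real (card (words X n)) \<le> K * real n"
proof -
  obtain x where x: "x \<in> X" using \<open>X \<noteq> {}\<close> by blast
  have "\<forall>u\<in>words X n. \<exists>p. subword x p n = u"
    using recurrent[OF x] unfolding words_def by blast
  then obtain f where f: "\<forall>u\<in>words X n. subword x (f u) n = u" by metis
  \<comment> \<open>\<open>I\<close> lies beyond one occurrence of each word. The last occurrence
    \<open>q\<close> up to \<open>I\<close> and the next one \<open>q'\<close> after
    \<open>I\<close> are consecutive, so \<open>q'\<close> is at most \<open>I + m\<close>.\<close>
  obtain I where I: "\<forall>p\<in>f ` words X n. p \<le> I"
    using finite_nat_set_iff_bounded_le[of "f ` words X n"] finite_words by auto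
  define m where "m = nat \<lfloor>K * real n\<rfloor>"
  have "\<exists>j\<in>{I<..I + m}. subword x j n = u" if u: "u \<in> words X n" for u
  proof -
    have len: "length u = n" and uL: "u \<in> language X" using u by (auto simp: words_def)
    let ?S = "{p. p \<le> I \<and> subword x p n = u}"
    have "f u \<in> ?S" using f I u by auto
    moreover have fS: "finite ?S" by simp
    ultimately have q: "Max ?S \<in> ?S" using Max_in by blast
    define q where "q = Max ?S"
    obtain q' where q': "I < q'" "subword x q' n = u" "\<And>p. I < p \<Longrightarrow> p < q' \<Longrightarrow> subword x p n \<noteq> u"
      using next_occurrence[OF x uL, of I] unfolding len by blast
    have qI: "q \<le> I" "subword x q n = u" using q by (auto simp: q_def)
    have "real q' \<le> real q + K * real n"
    proof (rule gap_le[OF K x n])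
      show "q < q'" "subword x q' n = subword x q n" using qI q' by auto
      show "subword x p n \<noteq> subword x q n" if "q < p" "p < q'" for p
      proof (cases "p \<le> I")
        case True
        show ?thesis
        proof
          assume "subword x p n = subword x q n"
          with True qI(2) have "p \<in> ?S" by simp
          then have "p \<le> q" unfolding q_def by (rule Max_ge[OF fS])
          with that(1) show False by simp
        qed
      next
        case False
        then show ?thesis using q'(3) that qI(2) by simp
      qed
    qed
    then have "int q' - int I \<le> \<lfloor>K * real n\<rfloor>" using qI(1) by (simp add: le_floor_iff)
    then have "q' \<le> I + m" unfolding m_def by linarith
    with q' show ?thesis by auto
  qed
  then have "words X n \<subseteq> (\<lambda>j. subword x j n) ` {I<..I + m}" by blast
  then have "card (words X n) \<le> card {I<..I + m}" by (rule surj_card_le[rotated]) simp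
  then have "real (card (words X n)) \<le> real m" by simp
  moreover have "0 \<le> K * real n"
    using recurrence_constant_ge_1[OF K \<open>X \<noteq> {}\<close>] by simp
  then have "real m \<le> K * real n" unfolding m_def by (simp add: of_nat_floor)
  ultimately show ?thesis by linarith
qed

section \<open>Number of left special points\<close>

text \<open>From length \<open>N\<close> on, each step adds at least \<open>card F\<close> words,
  against the upper bound \<open>K * real (N + k)\<close>. If \<open>card F\<close> exceeded
  \<open>K\<close>, large \<open>k\<close> would give a contradiction.\<close>

lemma card_finite_left_special_le:
  assumes K: "recurrence_constant X K" and ne: "X \<noteq> {}" and F: "finite F" "F \<subseteq> left_special X"
  shows "real (card F) \<le> K"
proof (rule ccontr)
  assume "\<not> real (card F) \<le> K"
  then have d: "0 < real (card F) - K" by simp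
  obtain N where N: "\<forall>x\<in>F. \<forall>y\<in>F. (\<forall>j<N. x j = y j) \<longrightarrow> x = y" using separating_prefix[OF F(1)] by blast
  have "k * card F \<le> card (words X (N + k))" for k
  proof (induction k)
    case (Suc k)
    have "\<forall>x\<in>F. \<forall>y\<in>F. (\<forall>j<N + k. x j = y j) \<longrightarrow> x = y" using N by (meson trans_less_add1)
    from card_words_Suc[OF F this] Suc show ?case by simp
  qed simp
  then have k: "real k * real (card F) \<le> K * real (N + k)" if "1 \<le> k" for k
    using card_words_le[OF K ne, of "N + k"] that by (smt (verit) of_nat_le_iff of_nat_mult trans_le_add2)
  obtain k where "K * real N < real k * (real (card F) - K)" using reals_Archimedean3[OF d] by blast
  \<comment> \<open>Passing to \<open>Suc k\<close> keeps the strict inequality and meets the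
    condition \<open>1 \<le> k\<close> of the fact \<open>k\<close>.\<close>
  moreover have "real k * (real (card F) - K) \<le> real (Suc k) * (real (card F) - K)"
    using d by (intro mult_right_mono) auto
  ultimately show False using k[of "Suc k"] by (simp add: algebra_simps)
qed

lemma card_left_special_le:
  assumes K: "recurrence_constant X K" and ne: "X \<noteq> {}"
  shows "finite (left_special X)" "real (card (left_special X)) \<le> K"
proof -
  show fin: "finite (left_special X)"
  proof (rule ccontr)
    assume "infinite (left_special X)"
    then obtain F where "finite F" "card F = Suc (nat \<lceil>K\<rceil>)" "F \<subseteq> left_special X"
      using infinite_arbitrarily_large by blast
    with card_finite_left_special_le[OF K ne, of F] show False by simp linarith
  qed
  then show "real (card (left_special X)) \<le> K"
    using card_finite_left_special_le[OF K ne] by blast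
qed

end

section \<open>Automorphism groups\<close>

lemma aut_carrier_iff:
  "f \<in> carrier (aut_group A X) \<longleftrightarrow> f \<in> Bij X \<and> continuous_map (shift_space A X) (shift_space A X) f \<and>
    (\<forall>x\<in>X. f (left_shift x) = left_shift (f x))"
  by (simp add: aut_group_def)

lemma aut_mem: "f \<in> carrier (aut_group A X) \<Longrightarrow> x \<in> X \<Longrightarrow> f x \<in> X"
  unfolding aut_carrier_iff using Bij_imp_funcset by blast

lemma aut_inj: "f \<in> carrier (aut_group A X) \<Longrightarrow> x \<in> X \<Longrightarrow> y \<in> X \<Longrightarrow> f x = f y \<Longrightarrow> x = y"
  unfolding aut_carrier_iff Bij_def bij_betw_def by (auto dest: inj_onD)

lemma aut_commute: "f \<in> carrier (aut_group A X) \<Longrightarrow> x \<in> X \<Longrightarrow> f (left_shift x) = left_shift (f x)"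
  unfolding aut_carrier_iff by blast

lemma aut_eqI:
  assumes "f \<in> carrier (aut_group A X)" "g \<in> carrier (aut_group A X)" "\<And>x. x \<in> X \<Longrightarrow> f x = g x"
  shows "f = g"
  using assms unfolding aut_carrier_iff by (meson Bij_imp_extensional extensionalityI)

lemma aut_mult:
  assumes "f \<in> carrier (aut_group A X)" "g \<in> carrier (aut_group A X)" "x \<in> X"
  shows "(f \<otimes>\<^bsub>aut_group A X\<^esub> g) x = f (g x)"
  using assms unfolding aut_carrier_iff by (simp add: aut_group_def BijGroup_def compose_def)

text \<open>Inside the group of bijections the point to check is the inverse: a continuous bijection
  of a compact Hausdorff space is a homeomorphism.\<close>

lemma group_aut_group:
  assumes fin: "finite A" and cl: "closedin (seq_topology A) X" and inv: "left_shift ` X \<subseteq> X"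
  shows "group (aut_group A X)"
proof -
  let ?T = "shift_space A X"
  let ?S = "{f \<in> Bij X. continuous_map ?T ?T f \<and> (\<forall>x\<in>X. f (left_shift x) = left_shift (f x))}"
  have tT: "topspace ?T = X" by (rule topspace_shift_space[OF cl])
  have "subgroup ?S (BijGroup X)"
  proof (rule group.subgroupI[OF group_BijGroup])
    show "?S \<subseteq> carrier (BijGroup X)" by (auto simp: BijGroup_def)
    have "(\<lambda>x\<in>X. x) \<in> ?S"
    proof -
      have "continuous_map ?T ?T (\<lambda>x\<in>X. x)"
        by (rule continuous_map_eq[OF continuous_map_id]) (simp add: tT)
      then show ?thesis using id_Bij[of X] inv by (auto simp: image_subset_iff)
    qed
    then show "?S \<noteq> {}" by blast
  next
    fix f assume f: "f \<in> ?S"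
    then have fB: "f \<in> Bij X" and bij: "bij_betw f X X" by (auto simp: Bij_def)
    let ?g = "\<lambda>x\<in>X. inv_into X f x"
    have "homeomorphic_map ?T ?T f"
      by (rule continuous_imp_homeomorphic_map)
        (use f bij in \<open>simp_all only: compact_shift_space[OF fin cl] Hausdorff_shift_space tT bij_betw_def mem_Collect_eq\<close>)
    then obtain g where g: "continuous_map ?T ?T g" "\<forall>x\<in>X. g (f x) = x" "\<forall>x\<in>X. f (g x) = x"
      unfolding homeomorphic_map_maps homeomorphic_maps_def tT by blast
    have gX: "g x \<in> X" if "x \<in> X" for x
      using g(1) that unfolding continuous_map_def tT by blast
    have gg: "?g x = g x" if "x \<in> X" for x
      using that g(3) gX bij by (metis bij_betw_def inv_into_f_f restrict_apply')
    have "continuous_map ?T ?T ?g"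
      by (rule continuous_map_eq[OF g(1)]) (simp only: tT gg)
    moreover have "?g (left_shift x) = left_shift (?g x)" if x: "x \<in> X" for x
    proof -
      have "f (left_shift (g x)) = left_shift x" using f g(3) gX x by simp
      then have "g (left_shift x) = left_shift (g x)"
        using g(2) gX[OF x] inv by (metis image_subset_iff)
      moreover have "left_shift x \<in> X" using inv x by blast
      ultimately show ?thesis by (simp only: gg x)
    qed
    ultimately show "inv\<^bsub>BijGroup X\<^esub> f \<in> ?S"
      using restrict_inv_into_Bij[OF fB] by (simp only: inv_BijGroup[OF fB]) blast
  next
    fix f g assume f: "f \<in> ?S" and g: "g \<in> ?S"
    have gX: "g x \<in> X" if "x \<in> X" for x
      using g that Bij_imp_funcset by blast
    have "continuous_map ?T ?T (compose X f g)"
      by (rule continuous_map_eq[of _ _ "f \<circ> g"])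
        (use f g in \<open>auto simp: tT compose_def intro: continuous_map_compose\<close>)
    moreover have "compose X f g (left_shift x) = left_shift (compose X f g x)" if "x \<in> X" for x
    proof -
      have "left_shift x \<in> X" using that inv by blast
      then show ?thesis using f g gX that by (simp add: compose_def)
    qed
    ultimately have "compose X f g \<in> ?S" using f g compose_Bij by blast
    then show "f \<otimes>\<^bsub>BijGroup X\<^esub> g \<in> ?S" using f g by (simp add: BijGroup_def)
  qed
  from group.subgroup_imp_group[OF group_BijGroup this] show ?thesis
    by (simp add: aut_group_def)
qed

text \<open>On \<open>S\<close> the map \<open>c\<close> factors through \<open>m\<close>. It is
  used to count cosets by an invariant whose equality forces equal cosets.\<close>

lemma card_image_le_if_coarser:
  assumes "\<And>a b. a \<in> S \<Longrightarrow> b \<in> S \<Longrightarrow> m a = m b \<Longrightarrow> c a = c b" "m ` S \<subseteq> M" "finite M"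
  shows "finite (c ` S)" "card (c ` S) \<le> card M"
proof -
  have "c a = c (inv_into S m (m a))" if "a \<in> S" for a
    using assms(1) that by (metis f_inv_into_f image_eqI inv_into_into)
  then have "c ` S \<subseteq> (\<lambda>v. c (inv_into S m v)) ` M" using assms(2) by blast
  then show "finite (c ` S)" "card (c ` S) \<le> card M"
    using assms(3) by (auto intro: finite_surj surj_card_le)
qed

section \<open>Bound for the one-sided automorphism group\<close>

context minimal_subshift
begin

lemma left_special_subset: "left_special X \<subseteq> X"
  using shift_closed by (auto simp: left_special_def)

lemma card_aut_group_le:
  assumes "finite (left_special X)" "left_special X \<noteq> {}"
  shows "finite (carrier (aut_group A X))" "card (carrier (aut_group A X)) \<le> card (left_special X)"
proof -
  obtain x where x: "x \<in> left_special X" using assms(2) by blast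
  have xX: "x \<in> X" using x left_special_subset by blast
  let ?T = "shift_space A X"
  have eq: "f = g" if f: "f \<in> carrier (aut_group A X)" and g: "g \<in> carrier (aut_group A X)" and fg: "f x = g x" for f g
  proof (rule aut_eqI[OF f g])
    fix z assume "z \<in> X"
    have orb: "h ((left_shift ^^ n) x) = (left_shift ^^ n) (h x) \<and> (left_shift ^^ n) x \<in> X"
      if "h \<in> carrier (aut_group A X)" for h n
      by (induction n) (simp_all add: xX shift_closed aut_commute[OF that])
    show "f z = g z"
    \<comment> \<open>Continuous maps into a Hausdorff space that agree on the dense orbit of
      \<open>x\<close> agree everywhere.\<close>
    proof (rule forall_in_closure_of_eq[where f = f and g = g, OF _ Hausdorff_shift_space[of A X]])
      show "z \<in> ?T closure_of range (\<lambda>n. (left_shift ^^ n) x)" using orbit_dense[OF xX] \<open>z \<in> X\<close> by simp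
      show "continuous_map ?T ?T f" "continuous_map ?T ?T g" using f g by (simp_all add: aut_carrier_iff)
      show "f y = g y" if "y \<in> range (\<lambda>n. (left_shift ^^ n) x)" for y
        using that orb[OF f] orb[OF g] fg by auto
    qed
  qed
  have "f x \<in> left_special X" if f: "f \<in> carrier (aut_group A X)" for f
  proof -
    obtain y z where "y \<in> X" "z \<in> X" "y \<noteq> z" "left_shift y = x" "left_shift z = x"
      using x unfolding left_special_def by blast
    \<comment> \<open>By injectivity the two preimages of \<open>x\<close> go to two preimages of
      \<open>f x\<close>.\<close>
    with f have "f y \<in> X" "f z \<in> X" "f y \<noteq> f z" "left_shift (f y) = f x" "left_shift (f z) = f x"
      using aut_mem[OF f] aut_inj[OF f] aut_commute[OF f] by metis+
    then show ?thesis unfolding left_special_def by blast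
  qed
  then have im: "(\<lambda>f. f x) ` carrier (aut_group A X) \<subseteq> left_special X" by blast
  have inj: "inj_on (\<lambda>f. f x) (carrier (aut_group A X))" using eq by (auto intro: inj_onI)
  show "finite (carrier (aut_group A X))" by (rule inj_on_finite[OF inj im assms(1)])
  show "card (carrier (aut_group A X)) \<le> card (left_special X)" by (rule card_inj_on_le[OF inj im assms(1)])
qed

end

section \<open>The two-sided version\<close>

lemma aut_shift_int:
  fixes Y :: "(int \<Rightarrow> 'a) set" and p :: int
  assumes f: "f \<in> carrier (aut_group A Y)" and Y: "\<And>y p. y \<in> Y \<Longrightarrow> (\<lambda>i. y (i + p)) \<in> Y" and y: "y \<in> Y"
  shows "f (\<lambda>i. y (i + p)) = (\<lambda>i. f y (i + p))"
proof -
  have pos: "f (\<lambda>i. z (i + int n)) = (\<lambda>i. f z (i + int n))" if "z \<in> Y" for z n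
  proof (induction n)
    case (Suc n)
    have "f (left_shift (\<lambda>i. z (i + int n))) = left_shift (\<lambda>i. f z (i + int n))"
      using aut_commute[OF f Y[OF that]] Suc by simp
    then show ?case by (simp add: left_shift_def algebra_simps)
  qed simp
  show ?thesis
  proof (cases "0 \<le> p")
    case True
    then show ?thesis using pos[OF y, of "nat p"] by simp
  next
    case False
    \<comment> \<open>For negative \<open>p\<close>, start from the point shifted by
      \<open>p\<close> and shift it back by the positive amount \<open>- p\<close>.\<close>
    have "f y = (\<lambda>i. f (\<lambda>i. y (i + p)) (i - p))"
      using pos[OF Y[OF y, of p], of "nat (- p)"] False by simp
    then show ?thesis by (simp add: fun_eq_iff)
  qed
qed

text \<open>The easy half of the Curtis--Hedlund--Lyndon theorem.\<close>

lemma aut_window: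
  fixes Y :: "(int \<Rightarrow> 'a) set"
  assumes fin: "finite A" and cl: "closedin (seq_topology A) Y"
    and Y: "\<And>y p. y \<in> Y \<Longrightarrow> (\<lambda>i. y (i + p)) \<in> Y" and f: "f \<in> carrier (aut_group A Y)"
  obtains r :: nat where "\<And>y z i k. y \<in> Y \<Longrightarrow> z \<in> Y \<Longrightarrow>
    (\<And>j. \<bar>j\<bar> \<le> int r \<Longrightarrow> y (i + j) = z (k + j)) \<Longrightarrow> f y i = f z k"
proof -
  have "\<exists>r. \<forall>y\<in>Y. \<forall>z\<in>Y. (\<forall>j\<in>{- int r..int r}. y j = z j) \<longrightarrow> f y 0 = f z 0"
  proof (rule uniform_window[OF fin cl])
    have "continuous_map (shift_space A Y) (seq_topology A) f"
      using f by (simp add: aut_carrier_iff continuous_map_in_subtopology)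
    from continuous_map_compose[OF this continuous_map_coordinate[of A 0]]
    show "continuous_map (shift_space A Y) (discrete_topology A) (\<lambda>y. f y 0)" by (simp add: o_def)
    show "incseq (\<lambda>r. {- int r..int r})" by (auto simp: incseq_def)
    show "f y 0 = f z 0" if "\<And>j. j \<in> (\<Union>r. {- int r..int r}) \<Longrightarrow> y j = z j" for y z
    proof -
      have "y j = z j" for j using that[of j] by (force intro: exI[of _ "nat \<bar>j\<bar>"])
      then show ?thesis by (metis ext)
    qed
  qed
  then obtain r where r: "\<And>y z. y \<in> Y \<Longrightarrow> z \<in> Y \<Longrightarrow> (\<forall>j\<in>{- int r..int r}. y j = z j) \<Longrightarrow> f y 0 = f z 0"
    by blast
  show ?thesis
  proof (rule that)
    fix y z i k
    assume yz: "y \<in> Y" "z \<in> Y" and "\<And>j. \<bar>j\<bar> \<le> int r \<Longrightarrow> y (i + j) = z (k + j)"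
    then have "\<forall>j\<in>{- int r..int r}. y (j + i) = z (j + k)" by (simp add: add.commute abs_le_iff)
    \<comment> \<open>Shifting moves both positions to 0, so the radius found there serves
      everywhere.\<close>
    from r[OF Y[OF yz(1)] Y[OF yz(2)] this] show "f y i = f z k"
      by (simp add: aut_shift_int[OF f Y] yz)
  qed
qed

section \<open>Structure of the two-sided version and its relation to one-sided points\<close>

context minimal_subshift
begin

abbreviation Y :: "(int \<Rightarrow> 'a) set" where
  "Y \<equiv> two_sided_version X"

text \<open>Since \<open>X\<close> is closed, its points are recognised by their words, so
  membership can be tested on right halves.\<close>

lemma two_sided_iff: "y \<in> Y \<longleftrightarrow> (\<forall>k. (\<lambda>n. y (k + int n)) \<in> X)"
proof
  assume y: "y \<in> Y"
  show "\<forall>k. (\<lambda>n. y (k + int n)) \<in> X"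
  proof
    fix k
    have "subword (\<lambda>n. y (k + int n)) 0 n = subword y k n" for n by (simp add: subword_def)
    then show "(\<lambda>n. y (k + int n)) \<in> X"
      using y by (intro mem_if_words_in_language) (simp add: two_sided_version_def)
  qed
next
  assume y: "\<forall>k. (\<lambda>n. y (k + int n)) \<in> X"
  have "subword y k n = subword (\<lambda>n. y (k + int n)) 0 n" for k n by (simp add: subword_def)
  then show "y \<in> Y" using y by (auto simp: two_sided_version_def intro: subword_in_language)
qed

lemma two_sided_half: "y \<in> Y \<Longrightarrow> (\<lambda>n. y (k + int n)) \<in> X"
  by (simp add: two_sided_iff)

lemma two_sided_shift: "y \<in> Y \<Longrightarrow> (\<lambda>i. y (i + p)) \<in> Y"
proof -
  assume "y \<in> Y"
  then have "(\<lambda>n. y (k + p + int n)) \<in> X" for k by (rule two_sided_half)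
  then show ?thesis by (simp add: two_sided_iff algebra_simps)
qed

lemma two_sided_letters: "y \<in> Y \<Longrightarrow> y i \<in> A"
  using letters[OF two_sided_half[of y i], of 0] by simp

lemma two_sided_closed: "closedin (seq_topology A) Y"
proof -
  have "seq_topology A closure_of Y \<subseteq> Y"
  proof
    fix z assume z: "z \<in> seq_topology A closure_of Y"
    have "subword z i n \<in> language X" for i n
    proof -
      have "finite {i..<i + int n}" by simp
      then obtain y where y: "y \<in> Y" "\<forall>j\<in>{i..<i + int n}. y j = z j"
        using z unfolding in_seq_closure_iff by meson
      then have "subword z i n = subword y i n" by (simp add: subword_eq_iff)
      then show ?thesis using y(1) by (simp add: two_sided_version_def)
    qed
    then show "z \<in> Y" by (simp add: two_sided_version_def)
  qed
  moreover have "Y \<subseteq> topspace (seq_topology A)"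
    using two_sided_letters by (auto simp: topspace_seq_topology)
  ultimately show ?thesis using closure_of_subset_eq by blast
qed

text \<open>The shift is onto, so \<open>x\<close> has an infinite chain of successive preimages
  \<open>z k\<close>; their first letters continue \<open>x\<close> to the left.\<close>

lemma two_sided_extension:
  assumes "x \<in> X"
  obtains y where "y \<in> Y" "\<And>n. y (int n) = x n"
proof -
  have "\<exists>z. z 0 = x \<and> (\<forall>k. z k \<in> X \<and> left_shift (z (Suc k)) = z k)"
  proof -
    have "\<exists>z. \<forall>k. (z k \<in> X \<and> (k = 0 \<longrightarrow> z k = x)) \<and> left_shift (z (Suc k)) = z k"
    proof (rule dependent_nat_choice)
      show "\<exists>z. z \<in> X \<and> (0 = 0 \<longrightarrow> z = x)" using assms by simp
      show "\<exists>w. (w \<in> X \<and> (Suc k = 0 \<longrightarrow> w = x)) \<and> left_shift w = z" if "z \<in> X \<and> (k = 0 \<longrightarrow> z = x)" for z k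
        using shift_surj[of z] that by auto
    qed
    then show ?thesis by blast
  qed
  then obtain z where z0: "z 0 = x" and zX: "\<And>k. z k \<in> X" and zS: "\<And>k. left_shift (z (Suc k)) = z k"
    by blast
  have zS': "z (Suc k) (Suc n) = z k n" for k n
    using zS[of k] by (simp add: left_shift_def fun_eq_iff)
  \<comment> \<open>Entries of the chain are constant along diagonals, so the right half of
    \<open>y\<close> from position \<open>- int m\<close> is exactly \<open>z m\<close>.\<close>
  have zz: "z (k + m) (n + m) = z k n" for k m n
    by (induction m) (simp_all add: zS')
  define y where "y i = (if 0 \<le> i then x (nat i) else z (nat (- i)) 0)" for i :: int
  have "(\<lambda>n. y (k + int n)) \<in> X" for k
  proof (cases "0 \<le> k")
    case True
    then have "(\<lambda>n. y (k + int n)) = (\<lambda>n. x (n + nat k))"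
      by (auto simp: y_def fun_eq_iff nat_add_distrib add.commute)
    then show ?thesis using shift_by_closed[OF assms] by simp
  next
    case False
    define m where "m = nat (- k)"
    have k: "k = - int m" using False by (simp add: m_def)
    have "y (k + int n) = z m n" for n
    proof (cases "m \<le> n")
      case True
      then have "y (k + int n) = z 0 (n - m)" by (simp add: y_def k z0 nat_diff_distrib)
      then show ?thesis using zz[of 0 m "n - m"] True by simp
    next
      case False
      then have "y (k + int n) = z (m - n) 0" by (simp add: y_def k nat_diff_distrib)
      then show ?thesis using zz[of "m - n" n 0] False by simp
    qed
    then show ?thesis using zX[of m] by simp
  qed
  then show ?thesis using that[of y] by (simp add: two_sided_iff y_def)
qed

text \<open>
  Every word of the language recurs arbitrarily far to the right in \<open>x\<close>, so the local rules of two
  automorphisms are determined by the right tails of their values at \<open>x\<close>.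
\<close>

lemma aut_eq_shift_if_tails_eq:
  assumes f: "f \<in> carrier (aut_group A Y)" and g: "g \<in> carrier (aut_group A Y)"
    and x: "x \<in> Y" and tail: "\<And>n. f x (k + int n) = g x (j + int n)" and z: "z \<in> Y"
  shows "f z i = g z (i + (j - k))"
proof -
  obtain r :: nat where r: "\<And>y z i k. y \<in> Y \<Longrightarrow> z \<in> Y \<Longrightarrow>
      (\<And>j. \<bar>j\<bar> \<le> int r \<Longrightarrow> y (i + j) = z (k + j)) \<Longrightarrow> f y i = f z k"
    using aut_window[OF finite_alphabet two_sided_closed two_sided_shift f] by blast
  obtain s :: nat where s: "\<And>y z i k. y \<in> Y \<Longrightarrow> z \<in> Y \<Longrightarrow>
      (\<And>j. \<bar>j\<bar> \<le> int s \<Longrightarrow> y (i + j) = z (k + j)) \<Longrightarrow> g y i = g z k"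
    using aut_window[OF finite_alphabet two_sided_closed two_sided_shift g] by blast
  \<comment> \<open>The radius must cover the windows of \<open>f\<close> and \<open>g\<close> and
    the offset between the two tails.\<close>
  define R where "R = r + s + nat \<bar>j - k\<bar>"
  let ?u = "subword z (i - int R) (2 * R + 1)"
  have "?u \<in> language X" using z by (simp add: two_sided_version_def)
  \<comment> \<open>The copy of the window of \<open>z\<close> is taken so far right that its centre
    \<open>q\<close> is at least \<open>k\<close>, where \<open>tail\<close> applies.\<close>
  then obtain p where p: "p \<ge> nat \<bar>k\<bar>" "subword (\<lambda>n. x (int n)) p (2 * R + 1) = ?u"
    using recurrent[OF two_sided_half[OF x, of 0], of ?u "nat \<bar>k\<bar>"] by auto
  define q where "q = int (p + R)"
  have q: "x (q + l) = z (i + l)" if "\<bar>l\<bar> \<le> int R" for l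
  proof -
    define m where "m = nat (l + int R)"
    have m: "int m = l + int R" "m < 2 * R + 1" using that by (auto simp: m_def)
    then have "x (int (p + m)) = z (i - int R + int m)"
      using p(2) unfolding subword_eq_iff by auto
    then show ?thesis by (simp add: q_def m(1) algebra_simps)
  qed
  have "f z i = f x q" by (rule r[OF z x]) (simp add: q R_def)
  also have "\<dots> = g x (q + (j - k))"
  proof -
    have "k + int (nat (q - k)) = q" using p(1) by (simp add: q_def)
    then have "j + int (nat (q - k)) = q + (j - k)" by linarith
    with \<open>k + int (nat (q - k)) = q\<close> show ?thesis using tail[of "nat (q - k)"] by (simp only:)
  qed
  also have "\<dots> = g z (i + (j - k))"
  proof (rule s[OF x z])
    fix l assume "\<bar>l\<bar> \<le> int s"
    then have "\<bar>l + (j - k)\<bar> \<le> int R" by (simp add: R_def)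
    from q[OF this] show "x (q + (j - k) + l) = z (i + (j - k) + l)" by (simp add: algebra_simps)
  qed
  finally show ?thesis .
qed

section \<open>Shift powers and their cosets\<close>

lemma group_two_sided: "group (aut_group A Y)"
proof (rule group_aut_group[OF finite_alphabet two_sided_closed])
  show "left_shift ` Y \<subseteq> Y"
    using two_sided_shift[of _ 1] by (auto simp: left_shift_def)
qed

lemma shift_aut: "restrict left_shift Y \<in> carrier (aut_group A Y)"
proof -
  have Y1: "left_shift y \<in> Y" if "y \<in> Y" for y
    using two_sided_shift[OF that, of 1] by (simp add: left_shift_def)
  have Y2: "(\<lambda>i. y (i - 1)) \<in> Y" if "y \<in> Y" for y
    using two_sided_shift[OF that, of "- 1"] by simp
  have "bij_betw (restrict left_shift Y) Y Y"
    by (rule bij_betw_byWitness[where f' = "\<lambda>y i. y (i - 1)"])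
      (use Y1 Y2 in \<open>auto simp: left_shift_def\<close>)
  moreover have "continuous_map (shift_space A Y) (shift_space A Y) (restrict left_shift Y)"
    by (rule continuous_map_eq[OF continuous_left_shift[OF two_sided_closed]]) (use Y1 in auto)
  ultimately show ?thesis using Y1 by (auto simp: aut_carrier_iff Bij_def)
qed

lemma shift_aut_pow:
  assumes "y \<in> Y"
  shows "(restrict left_shift Y [^]\<^bsub>aut_group A Y\<^esub> n) y = (\<lambda>i. y (i + int n))"
proof -
  interpret group "aut_group A Y" by (rule group_two_sided)
  show ?thesis using assms
  proof (induction n arbitrary: y)
    case 0
    then show ?case by (simp add: aut_group_def BijGroup_def)
  next
    case (Suc n)
    have "left_shift y \<in> Y" using two_sided_shift[OF Suc.prems, of 1] by (simp add: left_shift_def)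
    then have "(restrict left_shift Y [^]\<^bsub>aut_group A Y\<^esub> Suc n) y = (\<lambda>i. left_shift y (i + int n))"
      using Suc unfolding nat_pow_Suc aut_mult[OF nat_pow_closed[OF shift_aut] shift_aut Suc.prems]
      by (simp only: restrict_apply')
    also have "\<dots> = (\<lambda>i. y (i + int (Suc n)))" by (simp add: left_shift_def algebra_simps)
    finally show ?case .
  qed
qed

text \<open>As the cyclic subgroup generated by the shift, the powers form a subgroup, so equality
  of cosets can be tested on a representative.\<close>

lemma shift_powers_generate: "shift_powers A Y = generate (aut_group A Y) {restrict left_shift Y}"
  using group.generate_pow[OF group_two_sided shift_aut] by (auto simp: shift_powers_def)

text \<open>The hypothesis says that \<open>f\<close> is the \<open>n\<close>-th shift power times
  \<open>g\<close>. A negative offset is handled by exchanging \<open>f\<close> and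
  \<open>g\<close>.\<close>

lemma coset_eq_if_shifted:
  assumes f: "f \<in> carrier (aut_group A Y)" and g: "g \<in> carrier (aut_group A Y)"
    and fg: "\<And>z i. z \<in> Y \<Longrightarrow> f z i = g z (i + int n)"
  shows "shift_powers A Y #>\<^bsub>aut_group A Y\<^esub> f = shift_powers A Y #>\<^bsub>aut_group A Y\<^esub> g"
proof -
  interpret group "aut_group A Y" by (rule group_two_sided)
  let ?s = "restrict left_shift Y [^]\<^bsub>aut_group A Y\<^esub> int n"
  have s: "?s = restrict left_shift Y [^]\<^bsub>aut_group A Y\<^esub> n" by (simp add: int_pow_int)
  have sc: "?s \<in> carrier (aut_group A Y)" unfolding s by (rule nat_pow_closed[OF shift_aut])
  have "f = ?s \<otimes>\<^bsub>aut_group A Y\<^esub> g"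
  proof (rule aut_eqI[OF f m_closed[OF sc g]])
    fix z assume z: "z \<in> Y"
    have "(?s \<otimes>\<^bsub>aut_group A Y\<^esub> g) z = (\<lambda>i. g z (i + int n))"
      unfolding aut_mult[OF sc g z] unfolding s by (rule shift_aut_pow[OF aut_mem[OF g z]])
    with fg[OF z] show "f z = (?s \<otimes>\<^bsub>aut_group A Y\<^esub> g) z" by (simp only: fun_eq_iff simp_thms)
  qed
  moreover have "?s \<in> shift_powers A Y" by (auto simp: shift_powers_def)
  ultimately have "f \<in> shift_powers A Y #>\<^bsub>aut_group A Y\<^esub> g"
    unfolding r_coset_def by blast
  moreover have "subgroup (shift_powers A Y) (aut_group A Y)"
    unfolding shift_powers_generate by (rule generate_is_subgroup) (simp add: shift_aut)
  ultimately show ?thesis using repr_independence g by metis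
qed

section \<open>Bound for the two-sided quotient\<close>

lemma last_disagreement:
  fixes u v :: "int \<Rightarrow> 'b"
  assumes "u \<noteq> v" "\<And>i. N \<le> i \<Longrightarrow> u i = v i"
  obtains k where "u (k - 1) \<noteq> v (k - 1)" "\<And>i. k \<le> i \<Longrightarrow> u i = v i"
proof -
  obtain i0 where i0: "u i0 \<noteq> v i0" using assms(1) by blast
  \<comment> \<open>A known disagreement \<open>i0\<close> and the bound \<open>N\<close> make this
    set finite and nonempty; the position just after its maximum is \<open>k\<close>.\<close>
  let ?S = "{i \<in> {i0..N}. u i \<noteq> v i}"
  have S: "finite ?S" by (rule finite_subset[of _ "{i0..N}"]) auto
  have "i0 \<le> N" using i0 assms(2)[of i0] by linarith
  with i0 have "i0 \<in> ?S" by simp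
  then have m: "Max ?S \<in> ?S" using Max_in[OF S] by blast
  have "u i = v i" if "Max ?S + 1 \<le> i" for i
  proof (rule ccontr)
    assume "u i \<noteq> v i"
    moreover have "i0 \<le> i" using m that by simp
    moreover have "i \<le> N" using \<open>u i \<noteq> v i\<close> assms(2)[of i] by linarith
    ultimately have "i \<in> ?S" by simp
    from Max_ge[OF S this] that show False by simp
  qed
  moreover have "u (Max ?S + 1 - 1) \<noteq> v (Max ?S + 1 - 1)" using m by simp
  ultimately show ?thesis using that by blast
qed

lemma card_aut_quotient_le:
  assumes fin: "finite (left_special X)" and ne: "left_special X \<noteq> {}"
  shows "finite (carrier (aut_group A Y Mod shift_powers A Y))"
    "card (carrier (aut_group A Y Mod shift_powers A Y)) \<le> card (left_special X)"
proof -
  let ?G = "aut_group A Y"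
  \<comment> \<open>Two preimages of a left special point, extended to the left, give distinct
    points \<open>x\<close> and \<open>y\<close> that agree from position 1 on.\<close>
  obtain a b where ab: "a \<in> X" "b \<in> X" "a \<noteq> b" "left_shift a = left_shift b"
    using ne unfolding left_special_def by auto
  obtain x where x: "x \<in> Y" "\<And>n. x (int n) = a n" using two_sided_extension[OF ab(1)] by blast
  obtain y where y: "y \<in> Y" "\<And>n. y (int n) = b n" using two_sided_extension[OF ab(2)] by blast
  have xy: "x \<noteq> y" using x(2) y(2) ab(3) by (metis ext)
  have agree: "x i = y i" if "1 \<le> i" for i
  proof -
    have "i = int (Suc (nat (i - 1)))" using that by simp
    then obtain n where "i = int (Suc n)" by blast
    then show ?thesis using x(2)[of "Suc n"] y(2)[of "Suc n"] fun_cong[OF ab(4), of n]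
      by (simp add: left_shift_def)
  qed
  \<comment> \<open>The images differ by injectivity, and they agree as soon as the window of
    \<open>f\<close> lies in the common tail.\<close>
  have "\<exists>k. f x (k - 1) \<noteq> f y (k - 1) \<and> (\<forall>i\<ge>k. f x i = f y i)" if f: "f \<in> carrier ?G" for f
  proof -
    obtain r :: nat where r: "\<And>y z i k. y \<in> Y \<Longrightarrow> z \<in> Y \<Longrightarrow>
        (\<And>j. \<bar>j\<bar> \<le> int r \<Longrightarrow> y (i + j) = z (k + j)) \<Longrightarrow> f y i = f z k"
      using aut_window[OF finite_alphabet two_sided_closed two_sided_shift f] by blast
    have "f x \<noteq> f y" using aut_inj[OF f x(1) y(1)] xy by blast
    moreover have "f x i = f y i" if "int r + 1 \<le> i" for i
      by (rule r[OF x(1) y(1)]) (use that agree in auto)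
    ultimately show ?thesis by (metis last_disagreement)
  qed
  then obtain k where k1: "\<And>f. f \<in> carrier ?G \<Longrightarrow> f x (k f - 1) \<noteq> f y (k f - 1)"
    and k2: "\<And>f i. f \<in> carrier ?G \<Longrightarrow> k f \<le> i \<Longrightarrow> f x i = f y i"
    by metis
  let ?m = "\<lambda>f n. f x (k f + int n)"
  have "?m f \<in> left_special X" if f: "f \<in> carrier ?G" for f
  proof -
    \<comment> \<open>Starting one place earlier, at the last disagreement, the right halves of
      \<open>f x\<close> and \<open>f y\<close> are two distinct preimages of
      \<open>?m f\<close>.\<close>
    let ?h = "\<lambda>w n. f w (k f - 1 + int n)"
    have "?h x \<in> X" "?h y \<in> X"
      using two_sided_half[OF aut_mem[OF f]] x(1) y(1) by auto
    moreover have "?h x \<noteq> ?h y"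
      using k1[OF f] by (auto dest!: fun_cong[where x = 0])
    moreover have "left_shift (?h x) = ?m f" by (simp add: left_shift_def)
    moreover have "left_shift (?h y) = ?m f"
      using k2[OF f] by (simp add: left_shift_def)
    ultimately show ?thesis unfolding left_special_def by blast
  qed
  then have im: "?m ` carrier ?G \<subseteq> left_special X" by blast
  have coarser: "shift_powers A Y #>\<^bsub>?G\<^esub> f = shift_powers A Y #>\<^bsub>?G\<^esub> g"
    if f: "f \<in> carrier ?G" and g: "g \<in> carrier ?G" and m: "?m f = ?m g" for f g
  proof -
    \<comment> \<open>Equal invariants mean equal right tails at \<open>x\<close>, starting at
      \<open>k f\<close> and \<open>k g\<close>, so the automorphisms differ by the shift by
      \<open>k g - k f\<close>.\<close>
    have fg: "f z i = g z (i + (k g - k f))" if "z \<in> Y" for z i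
      by (rule aut_eq_shift_if_tails_eq[OF f g x(1) fun_cong[OF m] that])
    have gf: "g z i = f z (i + (k f - k g))" if "z \<in> Y" for z i
      using fg[OF that, of "i + (k f - k g)"] by simp
    show ?thesis
    proof (cases "k f \<le> k g")
      case True
      then show ?thesis using fg by (intro coset_eq_if_shifted[OF f g, of "nat (k g - k f)"]) simp
    next
      case False
      then show ?thesis using gf by (intro coset_eq_if_shifted[OF g f, of "nat (k f - k g)", symmetric]) simp
    qed
  qed
  have carr: "carrier (?G Mod shift_powers A Y) = (\<lambda>f. shift_powers A Y #>\<^bsub>?G\<^esub> f) ` carrier ?G"
    by (auto simp: FactGroup_def RCOSETS_def)
  note le = card_image_le_if_coarser[where S = "carrier ?G" and m = ?m
      and c = "\<lambda>f. shift_powers A Y #>\<^bsub>?G\<^esub> f" and M = "left_special X", OF coarser im fin]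
  show "finite (carrier (?G Mod shift_powers A Y))" unfolding carr by (rule le(1))
  show "card (carrier (?G Mod shift_powers A Y)) \<le> card (left_special X)"
    unfolding carr by (rule le(2))
qed

end

text \<open>Finiteness is asserted beside each bound because \<open>order\<close> of an infinite
  group is 0.\<close>

theorem corollary4p2:
  fixes A :: "'a set" and X :: "(nat \<Rightarrow> 'a) set" and K :: real
  assumes "finite A"
    and "linearly_recurrent A X"
    and "infinite X"
    and "recurrence_constant X K"
  shows "finite (carrier (aut_group A X)) \<and>
      real (order (aut_group A X)) \<le> 2 * (K + 1) * (2 * K + 3)\<^sup>2 \<and>
      finite (carrier (aut_group A (two_sided_version X) Mod shift_powers A (two_sided_version X))) \<and>
      real (order (aut_group A (two_sided_version X) Mod shift_powers A (two_sided_version X)))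
        \<le> 2 * (K + 1) * (2 * K + 3)\<^sup>2"
proof -
  interpret minimal_subshift A X
    using assms(1,2) by unfold_locales (simp_all add: linearly_recurrent_def)
  have ne: "X \<noteq> {}" using assms(3) by auto
  note fin = card_left_special_le(1)[OF assms(4) ne]
  note ls = left_special_nonempty[OF assms(3)]
  have K: "1 \<le> K" by (rule recurrence_constant_ge_1[OF assms(4) ne])
  \<comment> \<open>As \<open>1 \<le> K\<close>, the claimed bound is at least \<open>K + 1\<close>,
    hence at least the number of left special points.\<close>
  have "1 \<le> (2 * K + 3)\<^sup>2" using K by (intro one_le_power) simp
  then have "(K + 1) * 1 \<le> 2 * (K + 1) * (2 * K + 3)\<^sup>2"
    using K by (intro mult_mono) auto
  moreover have "real (card (left_special X)) \<le> K + 1"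
    using card_left_special_le(2)[OF assms(4) ne] by simp
  ultimately have bound: "real (card (left_special X)) \<le> 2 * (K + 1) * (2 * K + 3)\<^sup>2"
    unfolding mult_1_right by (rule order_trans[rotated])
  have "real (order (aut_group A X)) \<le> 2 * (K + 1) * (2 * K + 3)\<^sup>2"
    using card_aut_group_le(2)[OF fin ls] bound unfolding order_def by linarith
  moreover have "real (order (aut_group A Y Mod shift_powers A Y)) \<le> 2 * (K + 1) * (2 * K + 3)\<^sup>2"
    using card_aut_quotient_le(2)[OF fin ls] bound unfolding order_def by linarith
  ultimately show ?thesis
    using card_aut_group_le(1)[OF fin ls] card_aut_quotient_le(1)[OF fin ls] by (intro conjI)
qed

end
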